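(* Let $A=(a_{ij})\in\mathbb{R}^{N_c\times N_s}$ with $\|A\|_2=1$, let $(\hat a_{ij})$ be its row-wise Fourier transform, and let $K$ be the number of modes. Let $B$ be a parameterised circuit of $RBS$ gates, either pyramid-shaped (nearest-neighbour connectivity) or butterfly-shaped, on the $N_c+K$ qubits formed by the upper register ($N_c$ qubits) and the top $K$ qubits of the lower register. Let $W^1\in\mathbb{R}^{(N_c+K)\times(N_c+K)}$ and $W^2\in\mathbb{R}^{q\times q}$, $q=\binom{N_c+K}{2}$, be the matrices of $B$ on the Hamming-weight-$1$ and Hamming-weight-$2$ subspaces. (1) Applying $B$ to the state after the $QFT$ transforms the coefficients as follows. For the part that has Hamming weight $1$ on these $N_c+K$ qubits, $$b_{ij}=\sum_{t=1}^{N_c}W^1_{i,t}\,\hat a_{tj},\qquad i\in[1,N_c+K],\ j\in[K+1,N_s].$$ For the part that has Hamming weight $2$ on these qubits, $$c_{ij}=\sum_{s=1}^{N_c}\sum_{t=1}^{K}W^2_{\{i,N_c+j\},\{s,N_c+t\}}\,\hat a_{st},\qquad i\in[1,N_c],\ j\in[1,K].$$ If $B$ has nearest-neighbour connectivity, $W^2$ is the compound matrix of order $2$ of $W^1$, i.e. each of its entries is the determinant of a $2\times2$ submatrix of $W^1$. (2) After post-selecting the states that could have a non-zero coefficient before $B$, and applying $IQFT$ to the lower register, the output state of the composite quantum Fourier layer (a single circuit on $N_c+N_s$ qubits) is $$\sum_{i=1}^{N_c}|e_i\rangle\,IQFT\Big(\sum_{j=1}^{K}c_{ij}|e_j\rangle+\sum_{j=K+1}^{N_s}b_{ij}|e_j\rangle\Big).$$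 (3) The depth complexity of the circuit is $(N_c+K)+\log(N_c)+(N_c+2)\log(N_s)$ if $B$ is pyramid-shaped (the "Compound" version), and $\log(N_c+K)+\log(N_c)+(N_c+2)\log(N_s)$ if $B$ is butterfly-shaped (the "Butterfly" version).
   Context: **Unary states and gates.** $|e_i\rangle$ is the computational basis state of a register with a single $1$, on qubit $i$. $RBS(\theta)$ is the two-qubit gate fixing $|00\rangle,|11\rangle$ with $|01\rangle\mapsto\cos\theta|01\rangle-\sin\theta|10\rangle$ and $|10\rangle\mapsto\sin\theta|01\rangle+\cos\theta|10\rangle$. It preserves Hamming weight, so the unitary of a circuit of $RBS$ gates is block diagonal with one block per Hamming weight. On the $N_c+K$ qubits on which $B$ acts, upper qubits have positions $1,\dots,N_c$ and the top $K$ lower qubits have positions $N_c+1,\dots,N_c+K$; the weight-$1$ block is indexed by the position of the $1$, the weight-$2$ block by the pair of positions of the $1$s. **Circuit shapes.** A pyramid-shaped circuit applies $RBS$ gates only to neighbouring qubits; a butterfly-shaped circuit has the layout of the Cooley–Tukey FFT butterfly diagram, with a parameterised $RBS$ gate for each radix-2 operation. Each gate has its own trainable angle. **Fourier transform.** $QFT$ is the unary quantum Fourier transform: $QFT(\sum_j x_j|e_j\rangle)=\sum_j\hat x_j|e_j\rangle$, with $\hat x$ the (unitarily normalised) discrete Fourier transform of $x$; $IQFT$ is its inverse. **Composite quantum Fourier layer.** It starts in $|0\rangle^{\otimes N_c}\otimes|0\rangle^{\otimes N_s}$ (upper and lower registers) and consists of: 1. loading $A$, giving $\sum_{i,j}a_{ij}|e_i\rangle|e_j\rangle$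 (depth counted as $N_c\log N_s+\log N_c$); 2. $QFT$ on the lower register (depth counted as $\log N_s$), giving $\sum_{i,j}\hat a_{ij}|e_i\rangle|e_j\rangle$. On the $N_c+K$ qubits, the terms with $j\le K$ have Hamming weight $2$ and those with $j>K$ have Hamming weight $1$; 3. the circuit $B$ (depth counted as $N_c+K$ for the pyramid, $\log(N_c+K)$ for the butterfly); 4. post-selection keeping only the basis states $|e_i\rangle|e_j\rangle$ with $1\le i\le N_c$, $1\le j\le N_s$ (those that could have a non-zero coefficient before step 3); 5. $IQFT$ on the lower register (depth counted as $\log N_s$). The output state is written without a renormalisation factor for the post-selection. *)

theory Defs
  imports
    Complex_Main
    "HOL-Library.Function_Algebras"
    "Jordan_Normal_Form.Determinant"
begin

section \<open>States and operators on registers of qubits\<close>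

text \<open>
  Qubits are numbered by positive integers. A computational basis state is identified with the
  set of positions of its 1s, and a state is its family of amplitudes. The upper register
  consists of the qubits 1, ..., Nc and the lower register of the qubits Nc + 1, ..., Nc + Ns, so
  the unary state \<open>|e_i>\<close> of the upper register is \<open>ket {i}\<close>, the unary state
  \<open>|e_j>\<close> of the lower register is \<open>ket {Nc + j}\<close>, and \<open>|e_i>|e_j>\<close> is
  \<open>ket {i, Nc + j}\<close>.
\<close>

type_synonym qstate = "nat set \<Rightarrow> complex"

text \<open>Matrices in the computational basis; the first argument is the row (output).\<close>
type_synonym qop = "nat set \<Rightarrow> nat set \<Rightarrow> complex"

definition ket :: "nat set \<Rightarrow> qstate" where
  "ket T = (\<lambda>S. if S = T then 1 else 0)"

definition scale :: "complex \<Rightarrow> qstate \<Rightarrow> qstate" (infixr "*\<^sub>q" 75) where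
  "c *\<^sub>q \<psi> = (\<lambda>S. c * \<psi> S)"

definition state_on :: "nat set \<Rightarrow> qstate \<Rightarrow> bool" where
  "state_on R \<psi> \<longleftrightarrow> (\<forall>S. \<psi> S \<noteq> 0 \<longrightarrow> S \<subseteq> R)"

text \<open>
  The tensor product of a state of the register \<open>U\<close> and a state of qubits outside \<open>U\<close>.
\<close>
definition tensor :: "nat set \<Rightarrow> qstate \<Rightarrow> qstate \<Rightarrow> qstate" where
  "tensor U \<phi> \<psi> = (\<lambda>S. \<phi> (S \<inter> U) * \<psi> (S - U))"

text \<open>The operator \<open>M\<close> on the register \<open>R\<close>, tensored with the identity on all other qubits.\<close>
definition apply_on :: "nat set \<Rightarrow> qop \<Rightarrow> qstate \<Rightarrow> qstate" where
  "apply_on R M \<psi> = (\<lambda>S. \<Sum>T\<in>Pow R. M (S \<inter> R) T * \<psi> (T \<union> (S - R)))"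

text \<open>The part of a state that has Hamming weight \<open>k\<close> on the register \<open>R\<close>.\<close>
definition hw_part :: "nat set \<Rightarrow> nat \<Rightarrow> qstate \<Rightarrow> qstate" where
  "hw_part R k \<psi> = (\<lambda>S. if card (S \<inter> R) = k then \<psi> S else 0)"

section \<open>Circuits of RBS gates\<close>

text \<open>
  Matrix of the two-qubit gate: \<open>rbs_entry \<theta> x y\<close> is the coefficient of \<open>|x>\<close> in the image of
  \<open>|y>\<close>, with \<open>True\<close> for 1.
\<close>
fun rbs_entry :: "real \<Rightarrow> bool \<times> bool \<Rightarrow> bool \<times> bool \<Rightarrow> real" where
  "rbs_entry \<theta> x (False, True) =
     (if x = (False, True) then cos \<theta> else if x = (True, False) then - sin \<theta> else 0)"
| "rbs_entry \<theta> x (True, False) =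
     (if x = (False, True) then sin \<theta> else if x = (True, False) then cos \<theta> else 0)"
| "rbs_entry \<theta> x (False, False) = (if x = (False, False) then 1 else 0)"
| "rbs_entry \<theta> x (True, True) = (if x = (True, True) then 1 else 0)"

text \<open>\<open>RBS i j \<theta>\<close> has \<open>i\<close> as its first and \<open>j\<close> as its second qubit.\<close>
datatype gate = RBS (qubit1: nat) (qubit2: nat) (angle: real)

definition gate_matrix :: "gate \<Rightarrow> nat set \<Rightarrow> nat set \<Rightarrow> real" where
  "gate_matrix g S T = (let i = qubit1 g; j = qubit2 g in
     if S - {i, j} = T - {i, j}
     then rbs_entry (angle g) (i \<in> S, j \<in> S) (i \<in> T, j \<in> T) else 0)"

text \<open>A circuit is the list, in temporal order, of its layers of gates.\<close>
type_synonym circuit = "gate list list"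

text \<open>The matrix, on \<open>n\<close> qubits, of a list of gates; the head of the list acts first.\<close>
fun gates_matrix :: "nat \<Rightarrow> gate list \<Rightarrow> nat set \<Rightarrow> nat set \<Rightarrow> real" where
  "gates_matrix n [] S T = (if S = T then 1 else 0)"
| "gates_matrix n (g # gs) S T = (\<Sum>V\<in>Pow {1..n}. gates_matrix n gs S V * gate_matrix g V T)"

definition circuit_matrix :: "nat \<Rightarrow> circuit \<Rightarrow> nat set \<Rightarrow> nat set \<Rightarrow> real" where
  "circuit_matrix n B = gates_matrix n (concat B)"

text \<open>
  The blocks of Hamming weight 1 (indexed by the position of the 1) and 2 (indexed by the pair
  of positions of the 1s). That the matrix is block diagonal is \<open>circuit_matrix_block_diagonal\<close>
  below.
\<close>
definition weight1_matrix :: "nat \<Rightarrow> circuit \<Rightarrow> nat \<Rightarrow> nat \<Rightarrow> real" where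
  "weight1_matrix n B i t = circuit_matrix n B {i} {t}"

definition weight2_matrix :: "nat \<Rightarrow> circuit \<Rightarrow> nat set \<Rightarrow> nat set \<Rightarrow> real" where
  "weight2_matrix n B S T = (if card S = 2 \<and> card T = 2 then circuit_matrix n B S T else 0)"

text \<open>
  The compound matrix of order \<open>k\<close>: its entry at the \<open>k\<close>-element index sets \<open>S\<close>, \<open>T\<close> is the
  minor with rows \<open>S\<close> and columns \<open>T\<close>, both in increasing order.
\<close>
definition compound_matrix :: "nat \<Rightarrow> (nat \<Rightarrow> nat \<Rightarrow> real) \<Rightarrow> nat set \<Rightarrow> nat set \<Rightarrow> real" where
  "compound_matrix k M S T =
     det (mat k k (\<lambda>(r, s). M (sorted_list_of_set S ! r) (sorted_list_of_set T ! s)))"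

subsection \<open>Shapes\<close>

definition nearest_neighbour :: "circuit \<Rightarrow> bool" where
  "nearest_neighbour B \<longleftrightarrow>
     (\<forall>g\<in>set (concat B). qubit2 g = qubit1 g + 1 \<or> qubit1 g = qubit2 g + 1)"

text \<open>
  The pyramid with its \<open>n (n - 1) / 2\<close> gates: layer \<open>l\<close>, for \<open>1 \<le> l \<le> 2 n - 3\<close>, has the gates
  \<open>(i, i + 1)\<close> with \<open>i \<le> l\<close>, \<open>i \<le> 2 n - 2 - l\<close> and \<open>i\<close> of the same parity as \<open>l\<close>.
\<close>
definition pyramid_layout :: "nat \<Rightarrow> (nat \<times> nat) list list" where
  "pyramid_layout n =
     map (\<lambda>l. map (\<lambda>i. (i, i + 1))
             (filter (\<lambda>i. i \<le> l \<and> i \<le> 2 * n - 2 - l \<and> even (i + l)) [1..<n]))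
       [1..<2 * n - 2]"

text \<open>
  The butterfly diagram of the radix-2 FFT of length \<open>2 ^ m\<close>: the stage of span \<open>2 ^ s\<close> joins
  the (zero-based) positions that differ exactly in bit \<open>s\<close>. The spans increase in the
  decimation-in-time form; the decimation-in-frequency form is its reverse.
\<close>
definition butterfly_layout :: "nat \<Rightarrow> (nat \<times> nat) list list" where
  "butterfly_layout m =
     map (\<lambda>s. map (\<lambda>i. (i, i + 2 ^ s))
             (filter (\<lambda>i. even ((i - 1) div 2 ^ s)) [1..<2 ^ m + 1]))
       [0..<m]"

definition layout :: "circuit \<Rightarrow> (nat \<times> nat) list list" where
  "layout B = map (map (\<lambda>g. (qubit1 g, qubit2 g))) B"

datatype shape = Pyramid | Butterfly

text \<open>The shape fixes the positions of the gates only; the angle of each gate is free.\<close>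
fun has_shape :: "shape \<Rightarrow> nat \<Rightarrow> circuit \<Rightarrow> bool" where
  "has_shape Pyramid n B \<longleftrightarrow> layout B = pyramid_layout n"
| "has_shape Butterfly n B \<longleftrightarrow>
     (\<exists>m. n = 2 ^ m \<and> (layout B = butterfly_layout m \<or> layout B = rev (butterfly_layout m)))"

section \<open>Unary quantum Fourier transform\<close>

text \<open>Unitarily normalised discrete Fourier transform, with indices running from 1 to \<open>N\<close>.\<close>
definition dft :: "nat \<Rightarrow> (nat \<Rightarrow> complex) \<Rightarrow> nat \<Rightarrow> complex" where
  "dft N x j = (1 / of_real (sqrt (real N))) *
     (\<Sum>k=1..N. x k * cis (- 2 * pi * (real j - 1) * (real k - 1) / real N))"

text \<open>
  An operator on the lower register is a unary QFT if it acts as prescribed on the unary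
  states; its action on other states is left open.
\<close>
definition unary_qft :: "nat \<Rightarrow> nat \<Rightarrow> qop \<Rightarrow> bool" where
  "unary_qft Nc Ns Q \<longleftrightarrow>
     (\<forall>x. apply_on {Nc+1..Nc+Ns} Q (\<Sum>j=1..Ns. x j *\<^sub>q ket {Nc + j}) =
          (\<Sum>j=1..Ns. dft Ns x j *\<^sub>q ket {Nc + j}))"

definition inverse_op :: "nat set \<Rightarrow> qop \<Rightarrow> qop \<Rightarrow> bool" where
  "inverse_op R M' M \<longleftrightarrow> (\<forall>\<psi>. state_on R \<psi> \<longrightarrow>
     apply_on R M' (apply_on R M \<psi>) = \<psi> \<and> apply_on R M (apply_on R M' \<psi>) = \<psi>)"

section \<open>Composite quantum Fourier layer\<close>

definition frobenius_norm :: "nat \<Rightarrow> nat \<Rightarrow> (nat \<Rightarrow> nat \<Rightarrow> real) \<Rightarrow> real" where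
  "frobenius_norm m n a = sqrt (\<Sum>i=1..m. \<Sum>j=1..n. (a i j)\<^sup>2)"

definition loads :: "nat \<Rightarrow> nat \<Rightarrow> (nat \<Rightarrow> nat \<Rightarrow> real) \<Rightarrow> qop \<Rightarrow> bool" where
  "loads Nc Ns a L \<longleftrightarrow>
     apply_on {1..Nc+Ns} L (ket {}) = (\<Sum>i=1..Nc. \<Sum>j=1..Ns. of_real (a i j) *\<^sub>q ket {i, Nc + j})"

definition post_select :: "nat \<Rightarrow> nat \<Rightarrow> qstate \<Rightarrow> qstate" where
  "post_select Nc Ns \<psi> =
     (\<lambda>S. if \<exists>i\<in>{1..Nc}. \<exists>j\<in>{1..Ns}. S = {i, Nc + j} then \<psi> S else 0)"

datatype step = Load qop | Fourier qop | RBS_Circuit shape circuit | Post_Select | Inverse_Fourier qop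

fun run_step :: "nat \<Rightarrow> nat \<Rightarrow> nat \<Rightarrow> step \<Rightarrow> qstate \<Rightarrow> qstate" where
  "run_step Nc Ns K (Load L) \<psi> = apply_on {1..Nc+Ns} L \<psi>"
| "run_step Nc Ns K (Fourier Q) \<psi> = apply_on {Nc+1..Nc+Ns} Q \<psi>"
| "run_step Nc Ns K (RBS_Circuit sh B) \<psi> =
     apply_on {1..Nc+K} (\<lambda>S T. of_real (circuit_matrix (Nc + K) B S T)) \<psi>"
| "run_step Nc Ns K Post_Select \<psi> = post_select Nc Ns \<psi>"
| "run_step Nc Ns K (Inverse_Fourier Q') \<psi> = apply_on {Nc+1..Nc+Ns} Q' \<psi>"

definition run :: "nat \<Rightarrow> nat \<Rightarrow> nat \<Rightarrow> step list \<Rightarrow> qstate" where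
  "run Nc Ns K steps = fold (run_step Nc Ns K) steps (ket {})"

text \<open>
  Depth is a cost count, with binary logarithms. The pyramid is counted with its linear
  order of growth \<open>n\<close>, although its layout has \<open>2 n - 3\<close> layers; the count for the butterfly is
  the number of its layers. Post-selection contributes no gates.
\<close>
fun step_depth :: "nat \<Rightarrow> nat \<Rightarrow> nat \<Rightarrow> step \<Rightarrow> real" where
  "step_depth Nc Ns K (Load L) = real Nc * log 2 (real Ns) + log 2 (real Nc)"
| "step_depth Nc Ns K (Fourier Q) = log 2 (real Ns)"
| "step_depth Nc Ns K (RBS_Circuit sh B) =
     (case sh of Pyramid \<Rightarrow> real (Nc + K) | Butterfly \<Rightarrow> log 2 (real (Nc + K)))"
| "step_depth Nc Ns K Post_Select = 0"
| "step_depth Nc Ns K (Inverse_Fourier Q') = log 2 (real Ns)"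

definition depth :: "nat \<Rightarrow> nat \<Rightarrow> nat \<Rightarrow> step list \<Rightarrow> real" where
  "depth Nc Ns K steps = sum_list (map (step_depth Nc Ns K) steps)"

definition composite_layer :: "qop \<Rightarrow> qop \<Rightarrow> shape \<Rightarrow> circuit \<Rightarrow> qop \<Rightarrow> step list" where
  "composite_layer L Q sh B Q' =
     [Load L, Fourier Q, RBS_Circuit sh B, Post_Select, Inverse_Fourier Q']"

section \<open>Basic facts\<close>

lemma card_by_pair:
  assumes "finite S" "i \<noteq> j"
  shows "card S = card (S - {i, j}) + of_bool (i \<in> S) + of_bool (j \<in> S)"
proof -
  have "card S = card (S - {i, j}) + card (S \<inter> {i, j})"
    using assms by (metis card_Diff_subset_Int card_mono finite.emptyI finite.insertI finite_Int
        inf.cobounded1 le_add_diff_inverse2)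
  moreover have "card (S \<inter> {i, j}) = of_bool (i \<in> S) + of_bool (j \<in> S)"
    using assms(2) by (auto simp: Int_insert_right)
  ultimately show ?thesis by simp
qed

lemma rbs_entry_weight:
  assumes "rbs_entry \<theta> (u, v) (x, y) \<noteq> 0"
  shows "of_bool u + of_bool v = (of_bool x + of_bool y :: nat)"
  using assms by (cases u; cases v; cases x; cases y) simp_all

lemma gate_matrix_block_diagonal:
  assumes "finite S" "finite T" "qubit1 g \<noteq> qubit2 g" "gate_matrix g S T \<noteq> 0"
  shows "card S = card T"
proof -
  define i j where "i = qubit1 g" and "j = qubit2 g"
  have eq: "S - {i, j} = T - {i, j}"
    and "rbs_entry (angle g) (i \<in> S, j \<in> S) (i \<in> T, j \<in> T) \<noteq> 0"
    using assms(4) unfolding gate_matrix_def Let_def i_def j_def by (meson)+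
  from rbs_entry_weight[OF this(2)] show ?thesis
    using card_by_pair[OF assms(1), of i j] card_by_pair[OF assms(2), of i j] assms(3) eq
    unfolding i_def j_def by presburger
qed

lemma gates_matrix_block_diagonal:
  assumes "\<forall>g\<in>set gs. qubit1 g \<noteq> qubit2 g" "finite S" "finite T" "gates_matrix n gs S T \<noteq> 0"
  shows "card S = card T"
  using assms
proof (induction gs arbitrary: T)
  case (Cons g gs)
  have "(\<Sum>V\<in>Pow {1..n}. gates_matrix n gs S V * gate_matrix g V T) \<noteq> 0"
    using Cons.prems(4) by simp
  then obtain V where V: "V \<in> Pow {1..n}" "gates_matrix n gs S V * gate_matrix g V T \<noteq> 0"
    by (rule sum.not_neutral_contains_not_neutral)
  have fin: "finite V" using V(1) by (simp add: finite_subset[of V "{1..n}"])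
  have "card S = card V"
    using Cons.IH[of V] Cons.prems(1,2) V(2) fin by simp
  also have "\<dots> = card T"
    using gate_matrix_block_diagonal[of V T g] Cons.prems(1,3) V(2) fin by simp
  finally show ?case .
qed (simp split: if_splits)

lemma layout_qubits:
  assumes "g \<in> set (concat B)"
  shows "(qubit1 g, qubit2 g) \<in> set (concat (layout B))"
proof -
  from assms obtain l where "l \<in> set B" "g \<in> set l" by auto
  then show ?thesis by (force simp: layout_def)
qed

lemma pyramid_nearest_neighbour:
  assumes "has_shape Pyramid n B"
  shows "nearest_neighbour B"
  unfolding nearest_neighbour_def
proof
  fix g assume "g \<in> set (concat B)"
  from layout_qubits[OF this] assms
  show "qubit2 g = qubit1 g + 1 \<or> qubit1 g = qubit2 g + 1"
    by (auto simp: pyramid_layout_def split: if_splits)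
qed

lemma butterfly_layout_distinct:
  assumes "p \<in> set (concat (butterfly_layout m))"
  shows "fst p < snd p"
proof -
  from assms obtain l where l: "l \<in> set (butterfly_layout m)" and p: "p \<in> set l"
    by auto
  from l obtain s where
    s: "l = map (\<lambda>i. (i, i + 2 ^ s)) (filter (\<lambda>i. even ((i - 1) div 2 ^ s)) [1..<2 ^ m + 1])"
    unfolding butterfly_layout_def set_map by (elim imageE)
  from p obtain i where "p = (i, i + 2 ^ s)"
    unfolding s set_map by (elim imageE)
  then show ?thesis by simp
qed

lemma has_shape_distinct:
  assumes "has_shape sh n B" "g \<in> set (concat B)"
  shows "qubit1 g \<noteq> qubit2 g"
proof (cases sh)
  case Pyramid
  then show ?thesis
    using assms pyramid_nearest_neighbour[of n B] unfolding nearest_neighbour_def by fastforce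
next
  case Butterfly
  then obtain m where "layout B = butterfly_layout m \<or> layout B = rev (butterfly_layout m)"
    using assms(1) has_shape.simps(2) by blast
  then have "set (concat (layout B)) = set (concat (butterfly_layout m))"
    by (metis set_concat set_rev)
  then have "(qubit1 g, qubit2 g) \<in> set (concat (butterfly_layout m))"
    using layout_qubits[OF assms(2)] by (simp only:)
  from butterfly_layout_distinct[OF this] show ?thesis by simp
qed

lemma circuit_matrix_block_diagonal:
  assumes "has_shape sh n B" "S \<subseteq> {1..n}" "T \<subseteq> {1..n}" "card S \<noteq> card T"
  shows "circuit_matrix n B S T = 0"
proof (rule ccontr)
  assume "circuit_matrix n B S T \<noteq> 0"
  then have "gates_matrix n (concat B) S T \<noteq> 0" by (simp only: circuit_matrix_def not_False_eq_True)
  moreover have "\<forall>g\<in>set (concat B). qubit1 g \<noteq> qubit2 g"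
    using has_shape_distinct[OF assms(1)] by blast
  moreover have "finite S" "finite T"
    using assms(2,3) by (simp_all add: finite_subset[of _ "{1..n}"])
  ultimately show False
    using gates_matrix_block_diagonal[of "concat B" S T n] assms(4) by blast
qed

lemma pyramid_layers:
  assumes "has_shape Pyramid n B"
  shows "length B = 2 * n - 3"
proof -
  have "length B = length (layout B)" by (simp add: layout_def)
  also have "\<dots> = 2 * n - 3" using assms by (simp add: pyramid_layout_def)
  finally show ?thesis .
qed

lemma butterfly_layers:
  assumes "has_shape Butterfly n B"
  shows "real (length B) = log 2 (real n)"
proof -
  obtain m where m: "n = 2 ^ m" "layout B = butterfly_layout m \<or> layout B = rev (butterfly_layout m)"
    using assms by auto
  have "length B = length (layout B)" by (simp add: layout_def)
  also have "\<dots> = m" using m(2) by (auto simp: butterfly_layout_def)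
  finally show ?thesis using m(1) by (simp add: log_nat_power)
qed

end

theory Submission
  imports Defs
begin

text \<open>
  The QFT of the loaded state is a unary state on each register, so a circuit that preserves
  Hamming weight meets it only in weight 1 or weight 2; the amplitudes are read off directly. For
  the compound matrix, an RBS gate on neighbouring qubits acts in weight 2 by the minors of its
  weight-1 block, and by Cauchy--Binet this property is closed under composition.
\<close>

section \<open>Linearity of operators and tensor products\<close>

lemma apply_on_sum: "apply_on R M (\<Sum>x\<in>A. f x) = (\<Sum>x\<in>A. apply_on R M (f x))"
  by (rule ext, induction A rule: infinite_finite_induct)
    (simp_all add: apply_on_def distrib_left sum.distrib fun_eq_iff)

text \<open>All sets \<open>T \<union> (S - R)\<close> in the sum meet \<open>U\<close> in
  \<open>S \<inter> U\<close>, so the factor \<open>\<phi>\<close> is constant and comes out. This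
  lets an operator on the lower register act row by row, one upper index at a time.\<close>

lemma apply_on_tensor:
  assumes "R \<inter> U = {}"
  shows "apply_on R M (tensor U \<phi> \<chi>) = tensor U \<phi> (apply_on R M \<chi>)"
proof
  fix S
  have eq: "S \<inter> R = (S - U) \<inter> R" using assms by auto
  have "M (S \<inter> R) T * tensor U \<phi> \<chi> (T \<union> (S - R)) =
      \<phi> (S \<inter> U) * (M ((S - U) \<inter> R) T * \<chi> (T \<union> (S - U - R)))" if "T \<in> Pow R" for T
  proof -
    have "(T \<union> (S - R)) \<inter> U = S \<inter> U" "(T \<union> (S - R)) - U = T \<union> (S - U - R)"
      using assms that by auto
    then show ?thesis using eq by (simp add: tensor_def)
  qed
  then show "apply_on R M (tensor U \<phi> \<chi>) S = tensor U \<phi> (apply_on R M \<chi>) S"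
    by (simp add: apply_on_def tensor_def sum_distrib_left)
qed

lemma tensor_sum: "tensor U \<phi> (\<Sum>x\<in>A. f x) = (\<Sum>x\<in>A. tensor U \<phi> (f x))"
  by (rule ext, induction A rule: infinite_finite_induct)
    (simp_all add: tensor_def distrib_left fun_eq_iff)

lemma tensor_scale: "tensor U \<phi> (z *\<^sub>q \<chi>) = z *\<^sub>q tensor U \<phi> \<chi>"
  by (auto simp: tensor_def scale_def)

lemma tensor_ket:
  assumes "S \<subseteq> U" "T \<inter> U = {}"
  shows "tensor U (ket S) (ket T) = ket (S \<union> T)"
proof
  fix V
  have "V \<inter> U = S \<and> V - U = T \<longleftrightarrow> V = S \<union> T" using assms by auto
  then show "tensor U (ket S) (ket T) V = ket (S \<union> T) V"
    by (auto simp: tensor_def ket_def)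
qed

text \<open>Passes between the tensor form of a row, on which operators of the lower register act,
  and its basis expansion, from which amplitudes are read off.\<close>

lemma unary_register_sum:
  assumes "i \<in> {1..Nc}"
  shows "tensor {1..Nc} (ket {i}) (\<Sum>j=1..Ns. x j *\<^sub>q ket {Nc + j}) =
    (\<Sum>j=1..Ns. x j *\<^sub>q ket {i, Nc + j})"
  unfolding tensor_sum
proof (rule sum.cong)
  fix j assume "j \<in> {1..Ns}"
  then have "tensor {1..Nc} (ket {i}) (ket {Nc + j}) = ket ({i} \<union> {Nc + j})"
    using assms by (intro tensor_ket) auto
  then show "tensor {1..Nc} (ket {i}) (x j *\<^sub>q ket {Nc + j}) = x j *\<^sub>q ket {i, Nc + j}"
    by (simp add: tensor_scale insert_commute)
qed simp

section \<open>Amplitudes in the two-register unary basis\<close>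

lemma two_register_pair_eq:
  fixes i j i' j' Nc :: nat
  assumes "i \<le> Nc" "i' \<le> Nc" "1 \<le> j" "1 \<le> j'"
  shows "{i, Nc + j} = {i', Nc + j'} \<longleftrightarrow> i = i' \<and> j = j'"
  using assms by (auto simp: doubleton_eq_iff)

lemma sum_apply: "(\<Sum>x\<in>A. f x) S = (\<Sum>x\<in>A. (f x :: qstate) S)"
  by (induction A rule: infinite_finite_induct) auto

lemma two_register_amplitude:
  "(\<Sum>i=1..Nc. \<Sum>j=1..Ns. x i j *\<^sub>q ket {i, Nc + j}) S =
    (\<Sum>i=1..Nc. \<Sum>j=1..Ns. if S = {i, Nc + j} then x i j else 0)"
  by (simp add: sum_apply scale_def ket_def if_distrib cong: if_cong)

lemma two_register_amplitude_pair:
  assumes "i \<in> {1..Nc}" "j \<in> {1..Ns}"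
  shows "(\<Sum>i=1..Nc. \<Sum>j=1..Ns. x i j *\<^sub>q ket {i, Nc + j}) {i, Nc + j} = x i j"
proof -
  have "(\<Sum>i'=1..Nc. \<Sum>j'=1..Ns. if {i, Nc + j} = {i', Nc + j'} then x i' j' else 0) =
     (\<Sum>i'=1..Nc. \<Sum>j'=1..Ns. if i = i' then (if j = j' then x i' j' else 0) else 0)"
    using assms by (intro sum.cong refl) (simp add: two_register_pair_eq)
  also have "\<dots> = (\<Sum>i'=1..Nc. if i = i' then x i' j else 0)"
    using assms by (intro sum.cong refl) (auto simp: sum.delta')
  also have "\<dots> = x i j" using assms by (simp add: sum.delta')
  finally show ?thesis unfolding two_register_amplitude .
qed

text \<open>The filter on basis sets becomes an expansion, which can then be grouped into rows for
  the inverse transform.\<close>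

lemma post_select_sum:
  "post_select Nc Ns \<psi> = (\<Sum>i=1..Nc. \<Sum>j=1..Ns. \<psi> {i, Nc + j} *\<^sub>q ket {i, Nc + j})"
    (is "_ = ?r")
proof
  fix S
  show "post_select Nc Ns \<psi> S = ?r S"
  proof (cases "\<exists>i\<in>{1..Nc}. \<exists>j\<in>{1..Ns}. S = {i, Nc + j}")
    case True
    then obtain i j where ij: "i \<in> {1..Nc}" "j \<in> {1..Ns}" "S = {i, Nc + j}" by blast
    then show ?thesis
      using True two_register_amplitude_pair[OF ij(1,2), of "\<lambda>i j. \<psi> {i, Nc + j}"]
      by (simp only: post_select_def if_True)
  next
    case False
    then have "?r S = 0" unfolding two_register_amplitude by (intro sum.neutral ballI) auto
    with False show ?thesis unfolding post_select_def by simp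
  qed
qed

text \<open>\<open>Q\<close> is specified only on unary states of the lower register. Factoring the
  loaded state by its upper index presents exactly such a state in every row.\<close>

lemma load_then_fourier:
  assumes "loads Nc Ns a L" "unary_qft Nc Ns Q"
  shows "run Nc Ns K [Load L, Fourier Q] =
    (\<Sum>i=1..Nc. \<Sum>j=1..Ns. dft Ns (\<lambda>k. of_real (a i k)) j *\<^sub>q ket {i, Nc + j})"
proof -
  have "run Nc Ns K [Load L, Fourier Q] = apply_on {Nc+1..Nc+Ns} Q (apply_on {1..Nc+Ns} L (ket {}))"
    by (simp add: run_def)
  also have "apply_on {1..Nc+Ns} L (ket {}) =
      (\<Sum>i=1..Nc. tensor {1..Nc} (ket {i}) (\<Sum>j=1..Ns. of_real (a i j) *\<^sub>q ket {Nc + j}))"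
    using assms(1) unfolding loads_def by (simp only: unary_register_sum cong: sum.cong)
  also have "apply_on {Nc+1..Nc+Ns} Q \<dots> = (\<Sum>i=1..Nc. tensor {1..Nc} (ket {i})
      (apply_on {Nc+1..Nc+Ns} Q (\<Sum>j=1..Ns. of_real (a i j) *\<^sub>q ket {Nc + j})))"
    by (subst apply_on_sum) (intro sum.cong refl apply_on_tensor, auto)
  also have "\<dots> = (\<Sum>i=1..Nc. tensor {1..Nc} (ket {i})
      (\<Sum>j=1..Ns. dft Ns (\<lambda>k. of_real (a i k)) j *\<^sub>q ket {Nc + j}))"
    using assms(2) unfolding unary_qft_def by simp
  finally show ?thesis by (simp only: unary_register_sum cong: sum.cong)
qed

text \<open>The lower 1 at \<open>Nc + j\<close> lies outside the register of \<open>M\<close> and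
  is a spectator. The input amplitude at \<open>T \<union> {Nc + j}\<close> then vanishes unless
  \<open>T\<close> is a single upper qubit, so the support of the state selects the columns.\<close>

lemma weight1_amplitude:
  assumes "i \<in> {1..Nc+K}" "j \<in> {K+1..Ns}"
  shows "apply_on {1..Nc+K} M (\<Sum>i=1..Nc. \<Sum>j=1..Ns. x i j *\<^sub>q ket {i, Nc + j}) {i, Nc + j} =
    (\<Sum>t=1..Nc. M {i} {t} * x t j)"
proof -
  let ?\<phi> = "\<Sum>i=1..Nc. \<Sum>j=1..Ns. x i j *\<^sub>q ket {i, Nc + j}"
  have sets: "{i, Nc + j} \<inter> {1..Nc+K} = {i}" "{i, Nc + j} - {1..Nc+K} = {Nc + j}"
    using assms by auto
  have "apply_on {1..Nc+K} M ?\<phi> {i, Nc + j} =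
      (\<Sum>T\<in>Pow {1..Nc+K}. M {i} T * ?\<phi> (T \<union> {Nc + j}))"
    unfolding apply_on_def sets by simp
  also have "\<dots> = (\<Sum>T\<in>(\<lambda>t. {t}) ` {1..Nc}. M {i} T * ?\<phi> (T \<union> {Nc + j}))"
  proof (rule sum.mono_neutral_right)
    show "\<forall>T\<in>Pow {1..Nc+K} - (\<lambda>t. {t}) ` {1..Nc}. M {i} T * ?\<phi> (T \<union> {Nc + j}) = 0"
    proof
      fix T assume T: "T \<in> Pow {1..Nc+K} - (\<lambda>t. {t}) ` {1..Nc}"
      have "T \<union> {Nc + j} \<noteq> {t, Nc + j'}" if "t \<in> {1..Nc}" for t j'
      proof
        assume eq: "T \<union> {Nc + j} = {t, Nc + j'}"
        \<comment> \<open>\<open>Nc + j\<close> exceeds both the register and every upper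
          \<open>t\<close>, so it must be the lower element of the pair, which leaves
          \<open>T = {t}\<close>.\<close>
        have "Nc + j \<notin> T" using T assms by auto
        moreover have "t \<noteq> Nc + j" using that assms by auto
        moreover from this have "Nc + j = Nc + j'" using eq
          by (metis Un_insert_right insertE insertI1 singletonD)
        ultimately have "T = {t}" using eq by auto
        with T that show False by blast
      qed
      then have "?\<phi> (T \<union> {Nc + j}) = 0"
        unfolding two_register_amplitude by (intro sum.neutral ballI) auto
      then show "M {i} T * ?\<phi> (T \<union> {Nc + j}) = 0" by simp
    qed
  qed auto
  also have "\<dots> = (\<Sum>t=1..Nc. M {i} {t} * ?\<phi> {t, Nc + j})"
    by (simp add: sum.reindex inj_on_def insert_commute)
  also have "\<dots> = (\<Sum>t=1..Nc. M {i} {t} * x t j)"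
    using assms two_register_amplitude_pair[of _ Nc j Ns x] by (intro sum.cong refl) simp
  finally show ?thesis .
qed

text \<open>Here both 1s lie in the register of \<open>M\<close>, so an input set \<open>T\<close>
  must itself be a pair in the support of the state. Being contained in the register cuts its lower
  index down to \<open>t \<le> K\<close>.\<close>

lemma weight2_amplitude:
  assumes "i \<in> {1..Nc}" "j \<in> {1..K}" "K \<le> Ns"
  shows "apply_on {1..Nc+K} M (\<Sum>i=1..Nc. \<Sum>j=1..Ns. x i j *\<^sub>q ket {i, Nc + j}) {i, Nc + j} =
    (\<Sum>s=1..Nc. \<Sum>t=1..K. M {i, Nc + j} {s, Nc + t} * x s t)"
proof -
  let ?\<phi> = "\<Sum>i=1..Nc. \<Sum>j=1..Ns. x i j *\<^sub>q ket {i, Nc + j}"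
  let ?P = "(\<lambda>(s, t). {s, Nc + t}) ` ({1..Nc} \<times> {1..K})"
  have sets: "{i, Nc + j} \<inter> {1..Nc+K} = {i, Nc + j}" "{i, Nc + j} - {1..Nc+K} = {}"
    using assms by auto
  have inj: "inj_on (\<lambda>(s, t). {s, Nc + t}) ({1..Nc} \<times> {1..K})"
    by (intro inj_onI) (auto simp: two_register_pair_eq)
  have "apply_on {1..Nc+K} M ?\<phi> {i, Nc + j} = (\<Sum>T\<in>Pow {1..Nc+K}. M {i, Nc + j} T * ?\<phi> T)"
    unfolding apply_on_def sets by simp
  also have "\<dots> = (\<Sum>T\<in>?P. M {i, Nc + j} T * ?\<phi> T)"
  proof (rule sum.mono_neutral_right)
    show "\<forall>T\<in>Pow {1..Nc+K} - ?P. M {i, Nc + j} T * ?\<phi> T = 0"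
    proof
      fix T assume T: "T \<in> Pow {1..Nc+K} - ?P"
      have "T \<noteq> {s, Nc + t}" if "s \<in> {1..Nc}" "t \<in> {1..Ns}" for s t
      proof
        assume eq: "T = {s, Nc + t}"
        then have "t \<in> {1..K}" using T that by auto
        with eq that have "T \<in> ?P" by auto
        with T show False by blast
      qed
      then have "?\<phi> T = 0"
        unfolding two_register_amplitude by (intro sum.neutral ballI) auto
      then show "M {i, Nc + j} T * ?\<phi> T = 0" by simp
    qed
  qed auto
  also have "\<dots> = (\<Sum>(s, t)\<in>{1..Nc} \<times> {1..K}. M {i, Nc + j} {s, Nc + t} * ?\<phi> {s, Nc + t})"
    unfolding sum.reindex[OF inj] by (intro sum.cong) auto
  also have "\<dots> = (\<Sum>s=1..Nc. \<Sum>t=1..K. M {i, Nc + j} {s, Nc + t} * ?\<phi> {s, Nc + t})"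
    by (simp add: sum.cartesian_product)
  also have "\<dots> = (\<Sum>s=1..Nc. \<Sum>t=1..K. M {i, Nc + j} {s, Nc + t} * x s t)"
    using assms two_register_amplitude_pair[of _ Nc _ Ns x] by (intro sum.cong refl) simp
  finally show ?thesis .
qed

section \<open>Minors of order 2 and Cauchy--Binet\<close>

lemma sum_off_diagonal:
  fixes h :: "nat \<Rightarrow> nat \<Rightarrow> 'a::comm_monoid_add"
  assumes "finite A" "\<And>u. h u u = 0"
  shows "(\<Sum>u\<in>A. \<Sum>v\<in>A. h u v) = (\<Sum>u\<in>A. \<Sum>v\<in>A. if u < v then h u v + h v u else 0)"
proof -
  have "(\<Sum>u\<in>A. \<Sum>v\<in>A. h u v) =
      (\<Sum>u\<in>A. \<Sum>v\<in>A. (if u < v then h u v else 0) + (if v < u then h u v else 0))"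
  proof (intro sum.cong refl)
    fix u v
    show "h u v = (if u < v then h u v else 0) + (if v < u then h u v else 0)"
      by (cases u v rule: linorder_cases) (simp_all add: assms(2))
  qed
  also have "\<dots> = (\<Sum>u\<in>A. \<Sum>v\<in>A. if u < v then h u v else 0) +
      (\<Sum>u\<in>A. \<Sum>v\<in>A. if u < v then h v u else 0)"
    unfolding sum.distrib by (intro arg_cong2[where f = plus] refl sum.swap)
  also have "\<dots> = (\<Sum>u\<in>A. \<Sum>v\<in>A. if u < v then h u v + h v u else 0)"
    unfolding sum.distrib[symmetric] by (intro sum.cong refl) simp
  finally show ?thesis .
qed

text \<open>Written out on explicit indices so that Cauchy--Binet is algebra on finite sums;
  \<open>det\<close> and sorted index lists enter only in \<open>compound_matrix_2\<close>.\<close>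

definition minor2 :: "(nat \<Rightarrow> nat \<Rightarrow> real) \<Rightarrow> nat \<Rightarrow> nat \<Rightarrow> nat \<Rightarrow> nat \<Rightarrow> real" where
  "minor2 M p q r s = M p r * M q s - M p s * M q r"

text \<open>In the expanded double sum the factor from \<open>N\<close> is antisymmetric in
  \<open>u\<close> and \<open>v\<close>. The diagonal therefore vanishes, and the terms at
  \<open>(u, v)\<close> and \<open>(v, u)\<close> combine into a minor of \<open>M\<close> times a
  minor of \<open>N\<close>.\<close>

lemma Cauchy_Binet_2:
  assumes "finite A"
  shows "minor2 (\<lambda>i k. \<Sum>u\<in>A. M i u * N u k) p q r s =
    (\<Sum>u\<in>A. \<Sum>v\<in>A. if u < v then minor2 M p q u v * minor2 N u v r s else 0)"
proof -
  have "minor2 (\<lambda>i k. \<Sum>u\<in>A. M i u * N u k) p q r s =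
      (\<Sum>u\<in>A. \<Sum>v\<in>A. M p u * M q v * (N u r * N v s - N u s * N v r))"
    by (simp add: minor2_def sum_product sum_subtractf[symmetric] algebra_simps)
  also have "\<dots> = (\<Sum>u\<in>A. \<Sum>v\<in>A. if u < v then
      M p u * M q v * (N u r * N v s - N u s * N v r) +
      M p v * M q u * (N v r * N u s - N v s * N u r) else 0)"
    by (rule sum_off_diagonal) (use assms in auto)
  also have "\<dots> = (\<Sum>u\<in>A. \<Sum>v\<in>A. if u < v then minor2 M p q u v * minor2 N u v r s else 0)"
    by (intro sum.cong refl if_cong) (simp add: minor2_def algebra_simps)
  finally show ?thesis .
qed

section \<open>Sums over subsets of fixed cardinality\<close>

lemma sum_card_1_subsets:
  assumes "finite A" "\<And>V. V \<subseteq> A \<Longrightarrow> card V \<noteq> 1 \<Longrightarrow> f V = 0"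
  shows "(\<Sum>V\<in>Pow A. f V) = (\<Sum>u\<in>A. f {u})"
proof -
  have "(\<Sum>V\<in>Pow A. f V) = (\<Sum>V\<in>(\<lambda>u. {u}) ` A. f V)"
  proof (intro sum.mono_neutral_right ballI)
    fix V assume V: "V \<in> Pow A - (\<lambda>u. {u}) ` A"
    then have "card V \<noteq> 1" by (metis DiffE PowD card_1_singletonE image_eqI insert_subset)
    with V assms(2) show "f V = 0" by blast
  qed (use assms in auto)
  then show ?thesis by (simp add: sum.reindex inj_on_def)
qed

lemma card_2_ordered:
  assumes "card (V :: nat set) = 2"
  obtains u v where "u < v" "V = {u, v}"
  using assms by (metis card_2_iff insert_commute linorder_neqE_nat)

text \<open>Each 2-element set is represented by its increasing pair. A matrix product over the
  whole computational basis, restricted to weight 2, thus takes the index form of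
  \<open>Cauchy_Binet_2\<close>.\<close>

lemma sum_card_2_subsets:
  assumes "finite (A :: nat set)" "\<And>V. V \<subseteq> A \<Longrightarrow> card V \<noteq> 2 \<Longrightarrow> f V = 0"
  shows "(\<Sum>V\<in>Pow A. f V) = (\<Sum>u\<in>A. \<Sum>v\<in>A. if u < v then f {u, v} else 0)"
proof -
  let ?P = "{p \<in> A \<times> A. fst p < snd p}"
  have inj: "inj_on (\<lambda>p. {fst p, snd p}) ?P"
    by (intro inj_onI) (auto simp: doubleton_eq_iff)
  have "(\<Sum>V\<in>Pow A. f V) = (\<Sum>V\<in>(\<lambda>p. {fst p, snd p}) ` ?P. f V)"
  proof (rule sum.mono_neutral_right)
    show "\<forall>V\<in>Pow A - (\<lambda>p. {fst p, snd p}) ` ?P. f V = 0"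
    proof
      fix V assume V: "V \<in> Pow A - (\<lambda>p. {fst p, snd p}) ` ?P"
      have "card V \<noteq> 2"
      proof
        assume "card V = 2"
        then obtain u v where "u < v" "V = {u, v}" by (rule card_2_ordered)
        with V show False by (auto simp: image_iff)
      qed
      with V assms(2) show "f V = 0" by blast
    qed
  qed (use assms in auto)
  also have "\<dots> = (\<Sum>p\<in>?P. f {fst p, snd p})"
    by (simp add: sum.reindex[OF inj])
  also have "\<dots> = (\<Sum>p\<in>A \<times> A. if fst p < snd p then f {fst p, snd p} else 0)"
    using assms by (simp add: sum.inter_filter)
  also have "\<dots> = (\<Sum>u\<in>A. \<Sum>v\<in>A. if u < v then f {u, v} else 0)"
    by (simp add: sum.cartesian_product split_def)
  finally show ?thesis .
qed

section \<open>RBS gates and circuits in weights 1 and 2\<close>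

lemma gate_matrix_singleton:
  assumes "qubit1 g \<noteq> qubit2 g"
  shows "gate_matrix g {u} {r} =
    (if u = r then if u = qubit1 g \<or> u = qubit2 g then cos (angle g) else 1
     else if u = qubit1 g \<and> r = qubit2 g then - sin (angle g)
     else if u = qubit2 g \<and> r = qubit1 g then sin (angle g) else 0)"
proof (cases g)
  case (RBS i j \<theta>)
  with assms show ?thesis
    by (cases "u = i"; cases "u = j"; cases "r = i"; cases "r = j")
      (simp_all add: gate_matrix_def insert_Diff_if)
qed

lemma gate_matrix_inside:
  assumes "qubit1 g \<noteq> qubit2 g"
  shows "gate_matrix g {qubit1 g, qubit2 g} {qubit1 g, qubit2 g} = 1"
  by (simp add: gate_matrix_def Let_def)

lemma gate_matrix_outside:
  assumes "S \<inter> {qubit1 g, qubit2 g} = {}" "T \<inter> {qubit1 g, qubit2 g} = {}"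
  shows "gate_matrix g S T = (if S = T then 1 else 0)"
proof -
  have "S - {qubit1 g, qubit2 g} = S" "T - {qubit1 g, qubit2 g} = T"
    "qubit1 g \<notin> S" "qubit2 g \<notin> S" "qubit1 g \<notin> T" "qubit2 g \<notin> T"
    using assms by auto
  then show ?thesis by (simp add: gate_matrix_def Let_def)
qed

text \<open>With a single 1 on its own qubits, the gate sees the same two bits whether or not the
  outside 1 is present, and that outside 1 cannot move.\<close>

lemma gate_matrix_spectator:
  assumes "x \<in> {qubit1 g, qubit2 g}" "z \<in> {qubit1 g, qubit2 g}"
    "y \<notin> {qubit1 g, qubit2 g}" "w \<notin> {qubit1 g, qubit2 g}"
  shows "gate_matrix g {x, y} {z, w} = (if y = w then gate_matrix g {x} {z} else 0)"
proof -
  have "{x, y} - {qubit1 g, qubit2 g} = {y}" "{z, w} - {qubit1 g, qubit2 g} = {w}"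
    "{x} - {qubit1 g, qubit2 g} = {}" "{z} - {qubit1 g, qubit2 g} = {}"
    using assms by auto
  then show ?thesis using assms(3,4) by (simp add: gate_matrix_def Let_def)
qed

text \<open>Only for neighbouring qubits: otherwise moving the excitation past a third 1 strictly between
  them reorders the row indices and flips the sign of the minor.\<close>
lemma gate_matrix_pair:
  assumes nn: "qubit2 g = qubit1 g + 1 \<or> qubit1 g = qubit2 g + 1" and "u < v" "r < s"
  shows "gate_matrix g {u, v} {r, s} = minor2 (\<lambda>i k. gate_matrix g {i} {k}) u v r s"
proof -
  obtain i j \<theta> where g: "g = RBS i j \<theta>" by (cases g)
  define P where "P = {qubit1 g, qubit2 g}"
  have P: "P = {i, j}" by (simp add: P_def g)
  have ij: "j = i + 1 \<or> i = j + 1" using nn by (simp add: g)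
  have ne: "qubit1 g \<noteq> qubit2 g" using ij by (auto simp: g)
  define G where "G = (\<lambda>x z. gate_matrix g {x} {z})"
  have crossing: "G x z = 0" if "(x \<in> P) \<noteq> (z \<in> P)" for x z
    using that ne unfolding P G_def gate_matrix_singleton[OF ne] unfolding g
    by (cases "x = i"; cases "x = j"; cases "z = i"; cases "z = j") simp_all
  have outside: "G x z = (if x = z then 1 else 0)" if "x \<notin> P" "z \<notin> P" for x z
    using that unfolding P G_def gate_matrix_singleton[OF ne] unfolding g by simp
  \<comment> \<open>Nothing lies strictly between two neighbouring positions, so a qubit outside
    \<open>P\<close> is on the same side of both gate qubits.\<close>
  have below: "x < y" if "x < z" "z \<in> P" "y \<in> P" "x \<notin> P" for x y z
    using that ij unfolding P by auto
  have above: "y < x" if "z < x" "z \<in> P" "y \<in> P" "x \<notin> P" for x y z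
    using that ij unfolding P by auto
  have inside: "{x, y} = P" if "x < y" "x \<in> P" "y \<in> P" for x y
    using that unfolding P by auto
  have mixed: "gate_matrix g S T = 0" if "S - P \<noteq> T - P" for S T
    using that by (simp add: gate_matrix_def Let_def P_def)
  have spectator: "gate_matrix g {x, y} {z, w} = (if y = w then G x z else 0)"
    if "x \<in> P" "z \<in> P" "y \<notin> P" "w \<notin> P" for x y z w
    using that unfolding P_def G_def by (rule gate_matrix_spectator)
  have "gate_matrix g {u, v} {r, s} = G u r * G v s - G u s * G v r"
  \<comment> \<open>The split asks whether the diagonal product of the minor pairs rows and columns
    on the same side of \<open>P\<close>; if it does not, \<open>crossing\<close> makes that product
    0.\<close>
  proof (cases "(u \<in> P) = (r \<in> P) \<and> (v \<in> P) = (s \<in> P)")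
    case same: True
    consider (both) "u \<in> P" "v \<in> P" | (first) "u \<in> P" "v \<notin> P" | (second) "u \<notin> P" "v \<in> P"
      | (none) "u \<notin> P" "v \<notin> P"
      by blast
    then show ?thesis
    proof cases
      \<comment> \<open>The gate fixes the state with both of its qubits set, and the minor is the
        determinant of a rotation, so both sides are 1.\<close>
      case both
      have sets: "{u, v} = P" "{r, s} = P"
        using inside both same assms(2,3) by blast+
      have "r = u" "s = v"
        using assms(2,3) sets[folded sets(1)] by (auto simp: doubleton_eq_iff)
      moreover have "u = i \<and> v = j \<or> u = j \<and> v = i"
        using both assms(2) unfolding P by auto
      then have "G u u * G v v - G u v * G v u = 1"
        using ne sin_cos_squared_add3[of \<theta>]
        unfolding G_def gate_matrix_singleton[OF ne] unfolding g
        by (elim disjE conjE) simp_all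
      moreover have "gate_matrix g {u, v} {r, s} = 1"
        by (simp only: sets P_def gate_matrix_inside[OF ne])
      ultimately show ?thesis by simp
    next
      \<comment> \<open>The outside 1 is a spectator: the diagonal product gives the gate entry, and
        the other product vanishes by \<open>crossing\<close>.\<close>
      case first
      then have "r \<in> P" "s \<notin> P" using same by blast+
      with first show ?thesis
        using crossing[of u s] outside[of v s] spectator[of u r v s] by simp
    next
      case second
      then have "r \<notin> P" "s \<in> P" using same by blast+
      with second show ?thesis
        using crossing[of u s] outside[of u r] spectator[of v s u r] by (simp add: insert_commute)
    next
      case none
      then have r: "r \<notin> P" "s \<notin> P" using same by blast+
      have "gate_matrix g {u, v} {r, s} = (if {u, v} = {r, s} then 1 else 0)"
        using none r unfolding P_def by (intro gate_matrix_outside) blast+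
      also have "{u, v} = {r, s} \<longleftrightarrow> u = r \<and> v = s"
        using assms(2,3) by (auto simp: doubleton_eq_iff)
      finally have "gate_matrix g {u, v} {r, s} = (if u = r \<and> v = s then 1 else 0)" .
      moreover have "G u r * G v s = (if u = r \<and> v = s then 1 else 0)"
        by (simp only: outside[OF none(1) r(1)] outside[OF none(2) r(2)]) simp
      moreover have "u \<noteq> s \<or> v \<noteq> r" using assms(2,3) by linarith
      then have "G u s * G v r = 0"
        by (simp only: outside[OF none(1) r(2)] outside[OF none(2) r(1)]) auto
      ultimately show ?thesis by simp
    qed
  next
    case unequal: False
    then have "G u r * G v s = 0" using crossing[of u r] crossing[of v s] by fastforce
    \<comment> \<open>What remains is that the gate entry and the off-diagonal product vanish as
      well; distinct traces outside \<open>P\<close> give the former through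
      \<open>mixed\<close>.\<close>
    moreover have "{u, v} - P \<noteq> {r, s} - P \<and> G u s * G v r = 0"
    proof (cases "(u \<in> P) = (s \<in> P) \<and> (v \<in> P) = (r \<in> P)")
      \<comment> \<open>This is the case of a possible sign flip. A common outside qubit,
        \<open>v = r\<close> or \<open>u = s\<close>, would lie strictly between the two gate
        qubits, which \<open>below\<close> and \<open>above\<close> exclude.\<close>
      case crossed: True
      with unequal consider "u \<in> P" "s \<in> P" "v \<notin> P" "r \<notin> P" | "u \<notin> P" "s \<notin> P" "v \<in> P" "r \<in> P"
        by blast
      then show ?thesis
      proof cases
        case 1
        have "v \<noteq> r"
          using above[OF \<open>u < v\<close>, of s] below[OF \<open>r < s\<close>, of s] 1 assms(2,3) by force
        then show ?thesis using 1 outside[of v r] by auto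
      next
        case 2
        have "u \<noteq> s"
          using above[OF \<open>r < s\<close>, of v] below[OF \<open>u < v\<close>, of v] 2 assms(2,3) by force
        then show ?thesis using 2 outside[of u s] by auto
      qed
    next
      case False
      have "u \<noteq> v" "r \<noteq> s" using assms(2,3) by simp_all
      have card_Diff: "card ({x, y} - P) = of_bool (x \<notin> P) + of_bool (y \<notin> P)" if "x \<noteq> y" for x y
        using that by (simp add: insert_Diff_if)
      \<comment> \<open>As neither pairing respects membership in \<open>P\<close>, the two index
        pairs have different numbers of elements outside \<open>P\<close>.\<close>
      have "{u, v} - P \<noteq> {r, s} - P"
      proof
        assume "{u, v} - P = {r, s} - P"
        then have "of_bool (u \<notin> P) + of_bool (v \<notin> P) = (of_bool (r \<notin> P) + of_bool (s \<notin> P) :: nat)"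
          by (metis card_Diff \<open>u \<noteq> v\<close> \<open>r \<noteq> s\<close>)
        with False unequal show False
          by (cases "u \<in> P"; cases "v \<in> P"; cases "r \<in> P"; cases "s \<in> P") simp_all
      qed
      moreover have "G u s * G v r = 0"
        using False crossing[of u s] crossing[of v r] by fastforce
      ultimately show ?thesis by blast
    qed
    ultimately show ?thesis by (simp add: mixed del: mult_eq_0_iff)
  qed
  then show ?thesis by (simp only: minor2_def G_def)
qed

text \<open>Induction on the gates, with the columns \<open>r\<close>, \<open>s\<close> generalised
  because the head gate acts first and multiplies on the right. Weight preservation restricts the
  intermediate sets to pairs, and Cauchy--Binet recombines the minors of the two factors into a
  minor of the weight-1 product.\<close>

lemma gates_matrix_pair:
  assumes "\<forall>g\<in>set gs. qubit2 g = qubit1 g + 1 \<or> qubit1 g = qubit2 g + 1"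
    and "p < q" "r < s"
  shows "gates_matrix n gs {p, q} {r, s} = minor2 (\<lambda>i k. gates_matrix n gs {i} {k}) p q r s"
  using assms(1,3)
proof (induction gs arbitrary: r s)
  case Nil
  with assms(2) show ?case by (auto simp: minor2_def doubleton_eq_iff)
next
  case (Cons g gs)
  have ne: "\<forall>g\<in>set gs. qubit1 g \<noteq> qubit2 g" using Cons.prems(1) by auto
  have fin: "finite V" if "V \<subseteq> {1..n}" for V using that finite_subset by blast
  have zero: "gates_matrix n gs S V = 0" if "V \<subseteq> {1..n}" "finite S" "card V \<noteq> card S" for S V
    using gates_matrix_block_diagonal[OF ne that(2) fin[OF that(1)]] that(3) by metis
  have "gates_matrix n (g # gs) {p, q} {r, s} =
      (\<Sum>u\<in>{1..n}. \<Sum>v\<in>{1..n}. if u < v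
         then gates_matrix n gs {p, q} {u, v} * gate_matrix g {u, v} {r, s} else 0)"
    unfolding gates_matrix.simps using \<open>p < q\<close>
    by (intro sum_card_2_subsets) (auto intro!: zero)
  also have "\<dots> = (\<Sum>u\<in>{1..n}. \<Sum>v\<in>{1..n}. if u < v
         then minor2 (\<lambda>i k. gates_matrix n gs {i} {k}) p q u v *
           minor2 (\<lambda>i k. gate_matrix g {i} {k}) u v r s else 0)"
    using Cons.prems Cons.IH by (intro sum.cong refl if_cong) (simp add: gate_matrix_pair)
  also have "\<dots> = minor2 (\<lambda>i k. \<Sum>u\<in>{1..n}. gates_matrix n gs {i} {u} * gate_matrix g {u} {k}) p q r s"
    by (rule Cauchy_Binet_2[symmetric]) simp
  also have "(\<lambda>i k. \<Sum>u\<in>{1..n}. gates_matrix n gs {i} {u} * gate_matrix g {u} {k}) =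
      (\<lambda>i k. gates_matrix n (g # gs) {i} {k})"
    unfolding gates_matrix.simps
    by (intro ext sum_card_1_subsets[symmetric]) (auto intro!: zero)
  finally show ?case .
qed

section \<open>The compound matrix of order 2\<close>

lemma compound_matrix_2:
  assumes "p < q" "r < s"
  shows "compound_matrix 2 M {p, q} {r, s} = minor2 M p q r s"
proof -
  have lists: "sorted_list_of_set {p, q} = [p, q]" "sorted_list_of_set {r, s} = [r, s]"
    using assms by (simp_all add: insort_is_Cons)
  show ?thesis
    unfolding compound_matrix_def minor2_def lists
    \<comment> \<open>Expansion along the top row leaves 1 by 1 cofactors.\<close>
    by (subst laplace_expansion_row[where n = 2 and i = 0])
      (auto simp: cofactor_def mat_delete_def numeral_2_eq_2 det_single)
qed

lemma weight2_matrix_compound: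
  assumes "nearest_neighbour B" "card S = 2" "card T = 2"
  shows "weight2_matrix n B S T = compound_matrix 2 (weight1_matrix n B) S T"
proof -
  obtain p q r s where S: "p < q" "S = {p, q}" and T: "r < s" "T = {r, s}"
    using assms(2,3) card_2_ordered by metis
  have "weight2_matrix n B S T = minor2 (weight1_matrix n B) p q r s"
    using assms(1) gates_matrix_pair[OF _ S(1) T(1), of "concat B" n] assms(2,3)
    by (simp add: weight2_matrix_def weight1_matrix_def[abs_def] circuit_matrix_def
        nearest_neighbour_def S T del: set_concat)
  then show ?thesis using S T by (simp add: compound_matrix_2)
qed

section \<open>Coefficients, output state and depth of the layer\<close>

theorem mainTheorem4:
  fixes Nc Ns K :: nat
    and a :: "nat \<Rightarrow> nat \<Rightarrow> real" and a_hat :: "nat \<Rightarrow> nat \<Rightarrow> complex"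
    and L Q Q' :: qop and sh :: shape and B :: circuit
    and W1 :: "nat \<Rightarrow> nat \<Rightarrow> real" and W2 :: "nat set \<Rightarrow> nat set \<Rightarrow> real"
    and \<psi> :: qstate and b c :: "nat \<Rightarrow> nat \<Rightarrow> complex"
  assumes norm_a: "frobenius_norm Nc Ns a = 1"
    and a_hat: "a_hat = (\<lambda>i. dft Ns (\<lambda>k. of_real (a i k)))"
    and modes: "K \<le> Ns"
    and loader: "loads Nc Ns a L"
    and qft: "unary_qft Nc Ns Q"
    and iqft: "inverse_op {Nc+1..Nc+Ns} Q' Q"
    and B_shape: "has_shape sh (Nc + K) B"
    and W1: "W1 = weight1_matrix (Nc + K) B"
    and W2: "W2 = weight2_matrix (Nc + K) B"
    and after_B: "\<psi> = run Nc Ns K [Load L, Fourier Q, RBS_Circuit sh B]"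
    and b: "b = (\<lambda>i j. hw_part {1..Nc+K} 1 \<psi> {i, Nc + j})"
    and c: "c = (\<lambda>i j. hw_part {1..Nc+K} 2 \<psi> {i, Nc + j})"
  shows
    "\<comment> \<open>(1)\<close>
     (\<forall>i\<in>{1..Nc+K}. \<forall>j\<in>{K+1..Ns}. b i j = (\<Sum>t=1..Nc. of_real (W1 i t) * a_hat t j)) \<and>
     (\<forall>i\<in>{1..Nc}. \<forall>j\<in>{1..K}.
        c i j = (\<Sum>s=1..Nc. \<Sum>t=1..K. of_real (W2 {i, Nc + j} {s, Nc + t}) * a_hat s t)) \<and>
     (nearest_neighbour B \<longrightarrow>
        (\<forall>S T. S \<subseteq> {1..Nc+K} \<and> card S = 2 \<and> T \<subseteq> {1..Nc+K} \<and> card T = 2 \<longrightarrow>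
           W2 S T = compound_matrix 2 W1 S T)) \<and>
     \<comment> \<open>(2)\<close>
     run Nc Ns K (composite_layer L Q sh B Q') =
       (\<Sum>i=1..Nc. tensor {1..Nc} (ket {i})
          (apply_on {Nc+1..Nc+Ns} Q'
             ((\<Sum>j=1..K. c i j *\<^sub>q ket {Nc + j}) + (\<Sum>j=K+1..Ns. b i j *\<^sub>q ket {Nc + j})))) \<and>
     \<comment> \<open>(3)\<close>
     (sh = Pyramid \<longrightarrow>
        depth Nc Ns K (composite_layer L Q sh B Q') =
          real (Nc + K) + log 2 (real Nc) + (real Nc + 2) * log 2 (real Ns)) \<and>
     (sh = Butterfly \<longrightarrow>
        depth Nc Ns K (composite_layer L Q sh B Q') =
          log 2 (real (Nc + K)) + log 2 (real Nc) + (real Nc + 2) * log 2 (real Ns))"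
proof -
  let ?M = "\<lambda>S T. complex_of_real (circuit_matrix (Nc + K) B S T)"
  let ?R = "{1..Nc+K}"
  have \<psi>: "\<psi> = apply_on ?R ?M (\<Sum>i=1..Nc. \<Sum>j=1..Ns. a_hat i j *\<^sub>q ket {i, Nc + j})"
    using load_then_fourier[OF loader qft, of K] by (simp add: after_B run_def a_hat)
  \<comment> \<open>For \<open>j > K\<close> the lower 1 lies beyond the register of
    \<open>B\<close>, which sees weight 1; for \<open>j \<le> K\<close> it sees both 1s. In either
    range \<open>hw_part\<close> keeps the amplitude.\<close>
  have b_\<psi>: "b i j = \<psi> {i, Nc + j}" if "i \<in> ?R" "j \<in> {K+1..Ns}" for i j
  proof -
    have "{i, Nc + j} \<inter> ?R = {i}" using that by auto
    then show ?thesis by (simp add: b hw_part_def)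
  qed
  have c_\<psi>: "c i j = \<psi> {i, Nc + j}" if "i \<in> {1..Nc}" "j \<in> {1..K}" for i j
  proof -
    have "{i, Nc + j} \<inter> ?R = {i, Nc + j}" "i \<noteq> Nc + j" using that by auto
    then show ?thesis by (simp add: c hw_part_def)
  qed
  have part_b: "b i j = (\<Sum>t=1..Nc. of_real (W1 i t) * a_hat t j)"
    if "i \<in> ?R" "j \<in> {K+1..Ns}" for i j
    using weight1_amplitude[OF that] b_\<psi>[OF that] by (simp add: \<psi> W1 weight1_matrix_def)
  have part_c: "c i j = (\<Sum>s=1..Nc. \<Sum>t=1..K. of_real (W2 {i, Nc + j} {s, Nc + t}) * a_hat s t)"
    if "i \<in> {1..Nc}" "j \<in> {1..K}" for i j
  proof -
    have "W2 {i, Nc + j} {s, Nc + t} = circuit_matrix (Nc + K) B {i, Nc + j} {s, Nc + t}"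
      if "s \<in> {1..Nc}" "t \<in> {1..K}" for s t
    proof -
      \<comment> \<open>Both index sets have two elements, so the default value 0 of
        \<open>weight2_matrix\<close> does not arise.\<close>
      have "i \<noteq> Nc + j" "s \<noteq> Nc + t" using that \<open>i \<in> {1..Nc}\<close> \<open>j \<in> {1..K}\<close> by auto
      then show ?thesis by (simp add: W2 weight2_matrix_def)
    qed
    then show ?thesis
      using weight2_amplitude[OF that modes] c_\<psi>[OF that] by (simp add: \<psi>)
  qed
  let ?out = "\<lambda>i. (\<Sum>j=1..K. c i j *\<^sub>q ket {Nc + j}) + (\<Sum>j=K+1..Ns. b i j *\<^sub>q ket {Nc + j})"
  \<comment> \<open>Only rows with \<open>i \<le> Nc\<close> survive post-selection, although
    \<open>b\<close> also has rows up to \<open>Nc + K\<close>. Splitting a surviving row at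
    \<open>K\<close> separates the \<open>c\<close> part from the \<open>b\<close> part.\<close>
  have lower: "(\<Sum>j=1..Ns. \<psi> {i, Nc + j} *\<^sub>q ket {Nc + j}) = ?out i" if "i \<in> {1..Nc}" for i
  proof -
    have split: "{1..Ns} = {1..K} \<union> {K+1..Ns}" using modes by auto
    have "(\<Sum>j=1..Ns. \<psi> {i, Nc + j} *\<^sub>q ket {Nc + j}) =
        (\<Sum>j=1..K. \<psi> {i, Nc + j} *\<^sub>q ket {Nc + j}) +
        (\<Sum>j=K+1..Ns. \<psi> {i, Nc + j} *\<^sub>q ket {Nc + j})"
      unfolding split by (rule sum.union_disjoint) auto
    also have "\<dots> = ?out i"
      using that b_\<psi>[of i] c_\<psi>[of i] by (intro arg_cong2[of _ _ _ _ plus] sum.cong) auto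
    finally show ?thesis .
  qed
  have "run Nc Ns K (composite_layer L Q sh B Q') =
      apply_on {Nc+1..Nc+Ns} Q' (post_select Nc Ns \<psi>)"
    by (simp add: run_def composite_layer_def after_B)
  also have "post_select Nc Ns \<psi> = (\<Sum>i=1..Nc. tensor {1..Nc} (ket {i}) (?out i))"
    unfolding post_select_sum
  proof (rule sum.cong[OF refl])
    fix i assume "i \<in> {1..Nc}"
    then show "(\<Sum>j=1..Ns. \<psi> {i, Nc + j} *\<^sub>q ket {i, Nc + j}) = tensor {1..Nc} (ket {i}) (?out i)"
      by (simp only: lower[symmetric] unary_register_sum)
  qed
  also have "apply_on {Nc+1..Nc+Ns} Q' \<dots> =
      (\<Sum>i=1..Nc. tensor {1..Nc} (ket {i}) (apply_on {Nc+1..Nc+Ns} Q' (?out i)))"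
    by (subst apply_on_sum) (intro sum.cong refl apply_on_tensor, auto)
  finally have final_state: "run Nc Ns K (composite_layer L Q sh B Q') =
      (\<Sum>i=1..Nc. tensor {1..Nc} (ket {i}) (apply_on {Nc+1..Nc+Ns} Q' (?out i)))" .
  have compound: "W2 S T = compound_matrix 2 W1 S T"
    if "nearest_neighbour B" "card S = 2" "card T = 2" for S T
    unfolding W1 W2 using that by (rule weight2_matrix_compound)
  \<comment> \<open>The factor \<open>Nc + 2\<close> collects \<open>Nc\<close> from loading and one
    each from the transform and its inverse.\<close>
  have depth_eq: "depth Nc Ns K (composite_layer L Q sh' B Q') =
      (case sh' of Pyramid \<Rightarrow> real (Nc + K) | Butterfly \<Rightarrow> log 2 (real (Nc + K))) +
      log 2 (real Nc) + (real Nc + 2) * log 2 (real Ns)" for sh'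
    by (simp add: depth_def composite_layer_def algebra_simps)
  show ?thesis
    by (intro conjI impI ballI allI)
      (simp_all only: part_b part_c compound final_state depth_eq shape.case)
qed

end
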